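(* Let $\mathcal H$ be a separable complex Hilbert space and $S_2$ the Hilbert space of Hilbert–Schmidt operators on $\mathcal H$ with $\langle\eta,\tau\rangle_2=\operatorname{tr}(\eta^*\tau)$. If $A\in\mathcal B(S_2)$, then there exist sequences $\{a_n\},\{b_n\}\subset\mathcal B(\mathcal H)$ such that $A\eta=\sum_n a_n\eta b_n$ for all $\eta\in S_2$. *)

theory Defs
  imports "HOL-Analysis.Analysis"
begin

text \<open>A complex Hilbert space: a real Hilbert space (real inner product space,
  complete) whose vector-space structure extends to complex scalars, with
  multiplication by the imaginary unit preserving the real inner product.
  The complex inner product (linear in the second argument) is recovered
  as cinner below; its real part is the real inner product.\<close>

class complex_hilbert = real_inner + complete_space +
  fixes scaleC :: "complex \<Rightarrow> 'a \<Rightarrow> 'a"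
  assumes scaleC_add_right: "scaleC c (x + y) = scaleC c x + scaleC c y"
    and scaleC_add_left: "scaleC (c + d) x = scaleC c x + scaleC d x"
    and scaleC_scaleC: "scaleC c (scaleC d x) = scaleC (c * d) x"
    and scaleC_one: "scaleC 1 x = x"
    and scaleC_of_real: "scaleC (complex_of_real r) x = scaleR r x"
    and inner_scaleC_ii: "inner (scaleC \<i> x) (scaleC \<i> y) = inner x y"

definition cinner :: "'a::complex_hilbert \<Rightarrow> 'a \<Rightarrow> complex" where
  "cinner x y = Complex (inner x y) (- inner x (scaleC \<i> y))"

definition separable_space :: "'a::topological_space itself \<Rightarrow> bool" where
  "separable_space _ \<longleftrightarrow> (\<exists>D::'a set. countable D \<and> closure D = UNIV)"

definition clinear :: "('a::complex_hilbert \<Rightarrow> 'b::complex_hilbert) \<Rightarrow> bool" where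
  "clinear f \<longleftrightarrow> (\<forall>x y. f (x + y) = f x + f y) \<and> (\<forall>c x. f (scaleC c x) = scaleC c (f x))"

definition bounded_op :: "('a::complex_hilbert \<Rightarrow> 'a) \<Rightarrow> bool" where
  "bounded_op f \<longleftrightarrow> clinear f \<and> (\<exists>K. \<forall>x. norm (f x) \<le> K * norm x)"

definition is_onb :: "'a::complex_hilbert set \<Rightarrow> bool" where
  "is_onb E \<longleftrightarrow> (\<forall>e\<in>E. \<forall>f\<in>E. cinner e f = (if e = f then 1 else 0))
     \<and> (\<forall>x. (\<forall>e\<in>E. cinner e x = 0) \<longrightarrow> x = 0)"

definition some_onb :: "'a::complex_hilbert set" where
  "some_onb = (SOME E. is_onb E)"

definition hilbert_schmidt :: "('a::complex_hilbert \<Rightarrow> 'a) \<Rightarrow> bool" where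
  "hilbert_schmidt t \<longleftrightarrow> bounded_op t \<and>
     (\<exists>E. is_onb E \<and> (\<lambda>e. (norm (t e))\<^sup>2) summable_on E)"

text \<open>Hilbert--Schmidt inner product tr(eta^* tau) = sum_e <eta e, tau e>
  and the corresponding norm.\<close>
definition hs_inner :: "('a::complex_hilbert \<Rightarrow> 'a) \<Rightarrow> ('a \<Rightarrow> 'a) \<Rightarrow> complex" where
  "hs_inner s t = (\<Sum>\<^sub>\<infinity>e\<in>some_onb. cinner (s e) (t e))"

definition hs_norm :: "('a::complex_hilbert \<Rightarrow> 'a) \<Rightarrow> real" where
  "hs_norm t = sqrt (Re (hs_inner t t))"

definition bounded_op_S2 :: "(('a::complex_hilbert \<Rightarrow> 'a) \<Rightarrow> ('a \<Rightarrow> 'a)) \<Rightarrow> bool" where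
  "bounded_op_S2 A \<longleftrightarrow>
     (\<forall>t. hilbert_schmidt t \<longrightarrow> hilbert_schmidt (A t)) \<and>
     (\<forall>s t. hilbert_schmidt s \<longrightarrow> hilbert_schmidt t \<longrightarrow> A (\<lambda>x. s x + t x) = (\<lambda>x. A s x + A t x)) \<and>
     (\<forall>c t. hilbert_schmidt t \<longrightarrow> A (\<lambda>x. scaleC c (t x)) = (\<lambda>x. scaleC c (A t x))) \<and>
     (\<exists>K. \<forall>t. hilbert_schmidt t \<longrightarrow> hs_norm (A t) \<le> K * hs_norm t)"

end

theory Submission
  imports Defs "HOL-Library.Discrete_Functions"
begin

text \<open>Fix an orthonormal basis \<open>e\<^sub>n\<close> and let \<open>P\<^sub>m\<close> be the projection onto the span of the first
  \<open>m\<close> basis vectors. Put \<open>a\<^sub>l\<^sub>j x = A(|x\<rangle>\<langle>e\<^sub>l|) e\<^sub>j\<close>, which is bounded because \<open>A\<close> is, and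
  \<open>b\<^sub>l\<^sub>j = |e\<^sub>l\<rangle>\<langle>e\<^sub>j|\<close>. Then \<open>a\<^sub>l\<^sub>j \<eta> b\<^sub>l\<^sub>j\<close> is the \<open>j\<close>-th column of \<open>A(|\<eta> e\<^sub>l\<rangle>\<langle>e\<^sub>l|)\<close>, so a sum over
  index pairs whose first entries \<open>l\<close> in column \<open>j\<close> fill \<open>{0..<m(j)}\<close> has the error
  \<open>A(\<eta> - \<eta> P\<^bsub>m(j)\<^esub>) e\<^sub>j\<close> in column \<open>j\<close>. Since \<open>\<eta> P\<^sub>m \<rightarrow> \<eta>\<close> in \<open>S\<^sub>2\<close>, enumerating the pairs by growing
  squares makes the error tend to zero along all partial sums.\<close>

instance complex_hilbert \<subseteq> banach ..

subsection \<open>The complex inner product\<close>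

lemma scaleC_eq: "scaleC c x = Re c *\<^sub>R x + Im c *\<^sub>R scaleC \<i> x"
proof -
  have "scaleC c x = scaleC (complex_of_real (Re c) + complex_of_real (Im c) * \<i>) x"
    by (simp add: complex_eq[symmetric] mult.commute)
  also have "\<dots> = Re c *\<^sub>R x + Im c *\<^sub>R scaleC \<i> x"
    by (simp add: scaleC_add_left scaleC_scaleC[symmetric] scaleC_of_real)
  finally show ?thesis .
qed

lemma scaleC_ii_ii: "scaleC \<i> (scaleC \<i> x) = - x"
  using scaleC_of_real[of "-1" x] by (simp add: scaleC_scaleC)

text \<open>Multiplication by \<open>\<i>\<close> is an isometry whose square is minus the identity,
  hence it is skew-adjoint for the real inner product. Sesquilinearity of \<open>cinner\<close>
  rests on this.\<close>

lemma inner_scaleC_ii_left: "inner (scaleC \<i> x) y = - inner x (scaleC \<i> y)"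
  using inner_scaleC_ii[of x "scaleC \<i> y"] by (simp add: scaleC_ii_ii)

lemma scaleC_zero_right [simp]: "scaleC c 0 = 0"
  using scaleC_add_right[of c 0 0] by simp

lemma scaleC_zero_left [simp]: "scaleC 0 x = 0"
  using scaleC_add_left[of 0 0 x] by simp

lemma scaleC_minus_one [simp]: "scaleC (-1) x = - x"
  using scaleC_of_real[of "-1" x] by simp

lemma cinner_add_right: "cinner x (y + z) = cinner x y + cinner x z"
  by (simp add: cinner_def scaleC_add_right inner_add_right complex_eq_iff)

lemma cinner_scaleC_right: "cinner x (scaleC c y) = c * cinner x y"
proof -
  have "scaleC \<i> (scaleC c y) = Re c *\<^sub>R scaleC \<i> y - Im c *\<^sub>R y"
    using scaleC_eq[of c "scaleC \<i> y"] by (simp add: scaleC_scaleC mult.commute scaleC_ii_ii[unfolded scaleC_scaleC])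
  then show ?thesis
    unfolding cinner_def
    by (simp add: scaleC_eq[of c y] complex_eq_iff inner_add_right inner_diff_right)
qed

lemma cinner_commute: "cinner y x = cnj (cinner x y)"
  using inner_scaleC_ii_left[of x y]
  by (simp add: cinner_def complex_eq_iff inner_commute)

lemma cinner_zero_right [simp]: "cinner x 0 = 0"
  by (simp add: cinner_def complex_eq_iff)

lemma cinner_zero_left [simp]: "cinner 0 x = 0"
  by (simp add: cinner_def complex_eq_iff)

lemma cinner_minus_right: "cinner x (- y) = - cinner x y"
  using cinner_scaleC_right[of x "-1" y] by simp

lemma cinner_diff_right: "cinner x (y - z) = cinner x y - cinner x z"
  using cinner_add_right[of x y "- z"] by (simp add: cinner_minus_right)

lemma cinner_self: "cinner x x = complex_of_real ((norm x)\<^sup>2)"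
  using inner_scaleC_ii_left[of x x]
  by (simp add: cinner_def complex_eq_iff power2_norm_eq_inner inner_commute)

lemma cinner_scaleC_left: "cinner (scaleC c x) y = cnj c * cinner x y"
  using cinner_commute[of "scaleC c x" y] cinner_commute[of x y]
  by (simp add: cinner_scaleC_right)

lemma Re_cinner: "Re (cinner x y) = inner x y"
  by (simp add: cinner_def)

lemma norm_scaleC: "norm (scaleC c x) = cmod c * norm x"
proof -
  have "complex_of_real ((norm (scaleC c x))\<^sup>2) = cnj c * c * cinner x x"
    unfolding cinner_self[symmetric] by (simp add: cinner_scaleC_left cinner_scaleC_right)
  also have "\<dots> = complex_of_real ((cmod c * norm x)\<^sup>2)"
    by (simp add: cinner_self power_mult_distrib complex_norm_square[symmetric] mult_ac flip: of_real_power)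
  finally have "(norm (scaleC c x))\<^sup>2 = (cmod c * norm x)\<^sup>2"
    by (simp only: of_real_eq_iff)
  then show ?thesis by (simp add: power2_eq_iff_nonneg)
qed

text \<open>Scaling \<open>y\<close> by the conjugate of \<open>cinner x y\<close> makes the pairing
  real and nonnegative, which reduces the claim to the real Cauchy-Schwarz inequality.\<close>

lemma cinner_Cauchy_Schwarz: "cmod (cinner x y) \<le> norm x * norm y"
proof (cases "cinner x y = 0")
  case False
  have "(cmod (cinner x y))\<^sup>2 = Re (cinner x (scaleC (cnj (cinner x y)) y))"
    unfolding cinner_scaleC_right cmod_power2 by (simp add: power2_eq_square)
  also have "\<dots> \<le> norm x * norm (scaleC (cnj (cinner x y)) y)"
    unfolding Re_cinner by (rule norm_cauchy_schwarz)
  also have "\<dots> = cmod (cinner x y) * (norm x * norm y)"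
    by (simp add: norm_scaleC)
  finally show ?thesis using False
    by (simp add: power2_eq_square)
qed simp

lemma bounded_linear_cinner_right: "bounded_linear (cinner x)"
proof (rule bounded_linear_intro[where K = "norm x"])
  show "cinner x (r *\<^sub>R y) = r *\<^sub>R cinner x y" for r y
    using cinner_scaleC_right[of x "complex_of_real r" y]
    by (simp add: scaleC_of_real scaleR_conv_of_real)
  show "norm (cinner x y) \<le> norm y * norm x" for y
    using cinner_Cauchy_Schwarz[of x y] by (simp add: mult.commute)
qed (rule cinner_add_right)

text \<open>This follows from the parallelogram law; it gives closure of the Hilbert-Schmidt
  operators under sums.\<close>

lemma norm_add_sq_le:
  fixes x y :: "'a::real_inner"
  shows "(norm (x + y))\<^sup>2 \<le> 2 * (norm x)\<^sup>2 + 2 * (norm y)\<^sup>2"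
proof -
  have "(norm (x + y))\<^sup>2 + (norm (x - y))\<^sup>2 = 2 * (norm x)\<^sup>2 + 2 * (norm y)\<^sup>2"
    by (simp add: power2_norm_eq_inner inner_add inner_diff inner_commute)
  then show ?thesis by (smt (verit) zero_le_power2)
qed

subsection \<open>Bounded operators\<close>

lemma bounded_op_bounded_linear:
  assumes "bounded_op t"
  shows "bounded_linear t"
proof -
  obtain K where K: "\<And>x. norm (t x) \<le> K * norm x"
    using assms by (auto simp: bounded_op_def)
  show ?thesis
  proof (rule bounded_linear_intro[where K = K])
    show "t (r *\<^sub>R x) = r *\<^sub>R t x" for r x
      using assms unfolding bounded_op_def clinear_def by (metis scaleC_of_real)
  qed (use assms K in \<open>auto simp: bounded_op_def clinear_def mult.commute\<close>)
qed

lemma bounded_opI: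
  assumes "\<And>x y. t (x + y) = t x + t y" "\<And>c x. t (scaleC c x) = scaleC c (t x)"
    and "\<And>x. norm (t x) \<le> K * norm x"
  shows "bounded_op t"
  using assms by (auto simp: bounded_op_def clinear_def)

lemma bounded_op_zero: "bounded_op t \<Longrightarrow> t 0 = 0"
  using bounded_op_bounded_linear linear_simps(3) by blast

lemma bounded_op_scaleC: "bounded_op t \<Longrightarrow> t (scaleC c x) = scaleC c (t x)"
  by (simp add: bounded_op_def clinear_def)

lemma bounded_op_add:
  assumes "bounded_op s" "bounded_op t"
  shows "bounded_op (\<lambda>x. s x + t x)"
proof -
  obtain K L where KL: "\<And>x. norm (s x) \<le> K * norm x" "\<And>x. norm (t x) \<le> L * norm x"
    using assms by (auto simp: bounded_op_def)
  show ?thesis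
  proof (rule bounded_opI[where K = "K + L"])
    show "norm (s x + t x) \<le> (K + L) * norm x" for x
      using norm_triangle_ineq[of "s x" "t x"] KL[of x] by (simp add: distrib_right)
  qed (use assms in \<open>auto simp: bounded_op_def clinear_def scaleC_add_right\<close>)
qed

lemma bounded_op_scale:
  assumes "bounded_op t"
  shows "bounded_op (\<lambda>x. scaleC c (t x))"
proof -
  obtain K where K: "\<And>x. norm (t x) \<le> K * norm x"
    using assms by (auto simp: bounded_op_def)
  show ?thesis
  proof (rule bounded_opI[where K = "cmod c * K"])
    show "norm (scaleC c (t x)) \<le> cmod c * K * norm x" for x
      using mult_left_mono[OF K[of x], of "cmod c"] by (simp add: norm_scaleC mult.assoc)
  qed (use assms in \<open>auto simp: bounded_op_def clinear_def scaleC_add_right scaleC_scaleC mult.commute\<close>)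
qed

text \<open>In Dirac notation this is the operator \<open>|x><e|\<close>. It is linear in
  \<open>x\<close>, so that \<open>x\<close> can later serve as the argument of the coefficient
  operators.\<close>

definition rank_one :: "'a::complex_hilbert \<Rightarrow> 'a \<Rightarrow> 'a \<Rightarrow> 'a" where
  "rank_one x e y = scaleC (cinner e y) x"

lemma bounded_op_rank_one: "bounded_op (rank_one x e)"
proof (rule bounded_opI[where K = "norm e * norm x"])
  show "norm (rank_one x e y) \<le> norm e * norm x * norm y" for y
    using mult_right_mono[OF cinner_Cauchy_Schwarz[of e y], of "norm x"]
    by (simp add: rank_one_def norm_scaleC mult_ac)
qed (auto simp: rank_one_def cinner_add_right scaleC_add_left cinner_scaleC_right scaleC_scaleC)

subsection \<open>Orthonormal bases as sequences\<close>

text \<open>Zero entries are allowed, so that finite and infinite bases are sequences alike.\<close>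

definition onb_seq :: "(nat \<Rightarrow> 'a::complex_hilbert) \<Rightarrow> bool" where
  "onb_seq e \<longleftrightarrow> (\<forall>m n. m \<noteq> n \<longrightarrow> cinner (e m) (e n) = 0)
     \<and> (\<forall>n. e n = 0 \<or> norm (e n) = 1) \<and> (\<forall>x. (\<forall>n. cinner (e n) x = 0) \<longrightarrow> x = 0)"

lemma onb_seq_orth: "onb_seq e \<Longrightarrow> m \<noteq> n \<Longrightarrow> cinner (e m) (e n) = 0"
  by (simp add: onb_seq_def)

text \<open>The scalar is 1 at a unit vector and 0 at a zero entry. Carrying it along and absorbing
  it here treats both kinds of entries at once.\<close>

lemma onb_seq_scaleC_self: "onb_seq e \<Longrightarrow> scaleC (cinner (e n) (e n)) (e n) = e n"
  by (auto simp: onb_seq_def cinner_self scaleC_one dest!: spec[of _ n])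

lemma onb_seq_norm_le: "onb_seq e \<Longrightarrow> norm (e n) \<le> 1"
  by (auto simp: onb_seq_def dest!: spec[of _ n])

lemma rank_one_onb: "onb_seq e \<Longrightarrow> rank_one x (e m) (e n) = (if m = n then scaleC (cinner (e n) (e n)) x else 0)"
  by (simp add: rank_one_def onb_seq_orth)

section \<open>Fourier expansions with respect to a basis sequence\<close>

lemma onb_seq_norm_sum:
  assumes "onb_seq e" "finite I"
  shows "(norm (\<Sum>n\<in>I. scaleC (c n) (e n)))\<^sup>2 \<le> (\<Sum>n\<in>I. (cmod (c n))\<^sup>2)"
  using assms(2)
proof (induction I)
  case (insert k I)
  let ?s = "\<Sum>n\<in>I. scaleC (c n) (e n)"
  have "cinner (scaleC (c k) (e k)) ?s = (\<Sum>n\<in>I. cinner (scaleC (c k) (e k)) (scaleC (c n) (e n)))"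
    using bounded_linear_cinner_right by (rule linear_sum[OF bounded_linear.linear])
  also have "\<dots> = 0"
    using insert.hyps onb_seq_orth[OF assms(1), of k]
    by (intro sum.neutral) (metis cinner_scaleC_right cinner_scaleC_left mult_zero_right)
  finally have "inner (scaleC (c k) (e k)) ?s = 0"
    by (simp flip: Re_cinner)
  then have "(norm (scaleC (c k) (e k) + ?s))\<^sup>2 = (norm (scaleC (c k) (e k)))\<^sup>2 + (norm ?s)\<^sup>2"
    by (simp add: power2_norm_eq_inner inner_add inner_commute)
  \<comment> \<open>Pythagoras yields only an inequality, since a zero entry contributes nothing
    whatever \<open>c k\<close> is.\<close>
  moreover have "(norm (scaleC (c k) (e k)))\<^sup>2 \<le> (cmod (c k))\<^sup>2"
    using onb_seq_norm_le[OF assms(1), of k]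
    by (intro power_mono) (simp_all add: norm_scaleC mult_left_le)
  ultimately show ?case using insert by (simp del: power_mono_iff)
qed simp

lemma onb_seq_riesz_fischer:
  assumes "onb_seq e" "summable (\<lambda>n. (cmod (c n))\<^sup>2)"
  shows "summable (\<lambda>n. scaleC (c n) (e n))"
  unfolding summable_Cauchy
proof (intro allI impI)
  fix r :: real assume "r > 0"
  then obtain N where N: "\<And>m n. m \<ge> N \<Longrightarrow> norm (\<Sum>k=m..<n. (cmod (c k))\<^sup>2) < r\<^sup>2"
    using assms(2) unfolding summable_Cauchy by (meson zero_less_power)
  have "norm (\<Sum>k=m..<n. scaleC (c k) (e k)) < r" if "m \<ge> N" for m n
  proof -
    have "(norm (\<Sum>k=m..<n. scaleC (c k) (e k)))\<^sup>2 < r\<^sup>2"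
      using onb_seq_norm_sum[OF assms(1), of "{m..<n}" c] N[OF that, of n] by simp
    then show ?thesis using \<open>r > 0\<close> by (simp add: power_less_imp_less_base)
  qed
  then show "\<exists>N. \<forall>m\<ge>N. \<forall>n. norm (\<Sum>k=m..<n. scaleC (c k) (e k)) < r" by blast
qed

text \<open>Expand the square of \<open>norm (x - ?s)\<close>: the cross term is twice the
  coefficient sum, and the square of \<open>norm ?s\<close> is at most that sum.\<close>

lemma onb_seq_bessel:
  assumes "onb_seq e"
  shows "(\<Sum>n<N. (cmod (cinner (e n) x))\<^sup>2) \<le> (norm x)\<^sup>2"
proof -
  let ?c = "\<lambda>n. cinner (e n) x"
  let ?s = "\<Sum>n<N. scaleC (?c n) (e n)"
  have "inner x ?s = (\<Sum>n<N. inner x (scaleC (?c n) (e n)))"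
    by (simp add: inner_sum_right)
  also have "\<dots> = (\<Sum>n<N. (cmod (?c n))\<^sup>2)"
  proof (rule sum.cong)
    show "inner x (scaleC (?c n) (e n)) = (cmod (?c n))\<^sup>2" for n
      unfolding Re_cinner[symmetric] cinner_scaleC_right cinner_commute[of x "e n"] cmod_power2
      by (simp add: power2_eq_square)
  qed simp
  finally have *: "inner x ?s = (\<Sum>n<N. (cmod (?c n))\<^sup>2)" .
  have "0 \<le> (norm (x - ?s))\<^sup>2" by simp
  also have "\<dots> = (norm x)\<^sup>2 - 2 * inner x ?s + (norm ?s)\<^sup>2"
    by (simp add: power2_norm_eq_inner inner_diff inner_commute)
  finally show ?thesis
    using onb_seq_norm_sum[OF assms finite_lessThan[of N], of ?c] * by simp
qed

text \<open>Bessel and Riesz-Fischer give some limit \<open>y\<close> of the series;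
  \<open>x - y\<close> is orthogonal to every basis vector and so vanishes by completeness of the
  basis.\<close>

lemma onb_seq_expansion:
  assumes "onb_seq e"
  shows "(\<lambda>n. scaleC (cinner (e n) x) (e n)) sums x"
proof -
  let ?c = "\<lambda>n. cinner (e n) x"
  have "summable (\<lambda>n. (cmod (?c n))\<^sup>2)"
    by (rule summableI_nonneg_bounded[where x = "(norm x)\<^sup>2"]) (simp_all add: onb_seq_bessel assms)
  then have "summable (\<lambda>n. scaleC (?c n) (e n))"
    by (rule onb_seq_riesz_fischer[OF assms])
  then obtain y where y: "(\<lambda>n. scaleC (?c n) (e n)) sums y" by (auto simp: summable_def)
  have "cinner (e m) (x - y) = 0" for m
  proof -
    have "(\<lambda>n. cinner (e m) (scaleC (?c n) (e n))) sums cinner (e m) y"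
      by (rule bounded_linear.sums[OF bounded_linear_cinner_right y])
    moreover have "(\<lambda>n. cinner (e m) (scaleC (?c n) (e n))) = (\<lambda>n. if n = m then ?c m else 0)"
    proof
      fix n
      have "cinner (scaleC (cinner (e m) (e m)) (e m)) x = ?c m"
        by (simp add: onb_seq_scaleC_self assms)
      then show "cinner (e m) (scaleC (?c n) (e n)) = (if n = m then ?c m else 0)"
        using onb_seq_orth[OF assms, of m n]
        by (auto simp: cinner_scaleC_right cinner_scaleC_left cinner_self mult.commute)
    qed
    ultimately have "(\<lambda>n. if n = m then ?c m else 0) sums cinner (e m) y" by simp
    then have "cinner (e m) y = ?c m"
      using sums_single[of m "\<lambda>_. ?c m"] sums_unique2 by (simp add: sums_unique2)
    then show ?thesis by (simp add: cinner_diff_right)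
  qed
  then have "x - y = 0" using assms unfolding onb_seq_def by blast
  then show ?thesis using y by simp
qed

lemma onb_seq_parseval:
  assumes "onb_seq e"
  shows "(\<lambda>n. (cmod (cinner (e n) x))\<^sup>2) sums (norm x)\<^sup>2"
proof -
  have "(\<lambda>n. inner x (scaleC (cinner (e n) x) (e n))) sums inner x x"
    by (rule bounded_linear.sums[OF bounded_linear_inner_right onb_seq_expansion[OF assms]])
  moreover have "inner x (scaleC (cinner (e n) x) (e n)) = (cmod (cinner (e n) x))\<^sup>2" for n
    unfolding Re_cinner[symmetric] cinner_scaleC_right cinner_commute[of x "e n"] cmod_power2
    by (simp add: power2_eq_square)
  ultimately show ?thesis by (simp add: power2_norm_eq_inner)
qed

text \<open>The vector \<open>w\<close> is the adjoint of \<open>t\<close> applied to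
  \<open>g\<close>. Square summability of \<open>t\<close> on the basis makes the expected Fourier
  coefficients of \<open>w\<close> square summable, so \<open>w\<close> is defined by its
  series.\<close>

lemma onb_seq_riesz:
  assumes e: "onb_seq e" and t: "bounded_op t" and sm: "summable (\<lambda>n. (norm (t (e n)))\<^sup>2)"
  obtains w where "\<And>x. cinner w x = cinner g (t x)"
proof -
  define c where "c n = cnj (cinner g (t (e n)))" for n
  have "summable (\<lambda>n. (cmod (c n))\<^sup>2)"
  proof (rule summable_comparison_test'[where N = 0])
    show "summable (\<lambda>n. (norm g)\<^sup>2 * (norm (t (e n)))\<^sup>2)" by (rule summable_mult[OF sm])
    show "norm ((cmod (c n))\<^sup>2) \<le> (norm g)\<^sup>2 * (norm (t (e n)))\<^sup>2" for n
      using cinner_Cauchy_Schwarz[of g "t (e n)"]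
      by (simp add: c_def power_mono flip: power_mult_distrib)
  qed
  then have sc: "summable (\<lambda>n. scaleC (c n) (e n))" by (rule onb_seq_riesz_fischer[OF e])
  define w where "w = (\<Sum>n. scaleC (c n) (e n))"
  have wn: "cinner w (e m) = cinner g (t (e m))" for m
  proof -
    have "(\<lambda>n. cinner (e m) (scaleC (c n) (e n))) sums cinner (e m) w"
      unfolding w_def by (rule bounded_linear.sums[OF bounded_linear_cinner_right summable_sums[OF sc]])
    moreover have "(\<lambda>n. cinner (e m) (scaleC (c n) (e n))) = (\<lambda>n. if n = m then c m * cinner (e m) (e m) else 0)"
      using onb_seq_orth[OF e] by (auto simp: cinner_scaleC_right fun_eq_iff)
    ultimately have "(\<lambda>n. if n = m then c m * cinner (e m) (e m) else 0) sums cinner (e m) w" by simp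
    then have "cinner (e m) w = c m * cinner (e m) (e m)"
      using sums_single[of m "\<lambda>_. c m * cinner (e m) (e m)"] by (simp add: sums_unique2)
    then have "cinner w (e m) = cinner (e m) (e m) * cinner g (t (e m))"
      by (subst cinner_commute) (simp add: c_def cinner_self)
    also have "\<dots> = cinner g (t (scaleC (cinner (e m) (e m)) (e m)))"
      by (simp only: bounded_op_scaleC[OF t] cinner_scaleC_right)
    finally show ?thesis by (simp add: onb_seq_scaleC_self e)
  qed
  \<comment> \<open>Agreement on the basis extends to all \<open>x\<close> by expanding
    \<open>x\<close> and using continuity of both sides.\<close>
  have "cinner w x = cinner g (t x)" for x
  proof -
    have "(\<lambda>n. cinner w (scaleC (cinner (e n) x) (e n))) sums cinner w x"
      by (rule bounded_linear.sums[OF bounded_linear_cinner_right onb_seq_expansion[OF e]])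
    moreover have "(\<lambda>n. cinner g (t (scaleC (cinner (e n) x) (e n)))) sums cinner g (t x)"
      by (intro bounded_linear.sums[OF bounded_linear_cinner_right]
            bounded_linear.sums[OF bounded_op_bounded_linear[OF t]] onb_seq_expansion[OF e])
    ultimately show ?thesis
      by (simp add: bounded_op_scaleC[OF t] cinner_scaleC_right wn sums_unique2)
  qed
  then show thesis by (rule that)
qed

text \<open>Both sides are compared with the Hilbert--Schmidt sum of the adjoint, whose values on
  \<open>f\<close> are the vectors \<open>w m\<close>.\<close>

lemma hilbert_schmidt_sum_basis_independent:
  assumes e: "onb_seq e" and f: "onb_seq f" and t: "bounded_op t"
    and sm: "summable (\<lambda>n. (norm (t (e n)))\<^sup>2)"
  shows "summable (\<lambda>n. (norm (t (f n)))\<^sup>2)"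
proof -
  define C where "C = (\<Sum>n. (norm (t (e n)))\<^sup>2)"
  have "\<exists>w. \<forall>m x. cinner (w m) x = cinner (f m) (t x)"
    by (rule choice) (metis onb_seq_riesz[OF e t sm])
  then obtain w where w: "\<And>m x. cinner (w m) x = cinner (f m) (t x)" by blast
  have w_sums: "(\<lambda>n. (cmod (cinner (f m) (t (e n))))\<^sup>2) sums (norm (w m))\<^sup>2" for m
  proof -
    have "cmod (cinner (e n) (w m)) = cmod (cinner (f m) (t (e n)))" for n
      by (simp add: w[symmetric] cinner_commute[of "e n" "w m"])
    then show ?thesis using onb_seq_parseval[OF e, of "w m"] by simp
  qed
  \<comment> \<open>Taking \<open>M\<close> rows at a time keeps the interchange of sums finite;
    Bessel for \<open>f\<close> at \<open>t (e n)\<close> bounds each term of the series. The bound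
    for \<open>t\<close> on \<open>f\<close> below works in the same way, with Bessel at
    \<open>w m\<close>.\<close>
  have "(\<Sum>m<M. (norm (w m))\<^sup>2) \<le> C" for M
    unfolding C_def
  proof (rule sums_le)
    show "(\<lambda>n. \<Sum>m<M. (cmod (cinner (f m) (t (e n))))\<^sup>2) sums (\<Sum>m<M. (norm (w m))\<^sup>2)"
      by (intro sums_sum w_sums)
    show "(\<lambda>n. (norm (t (e n)))\<^sup>2) sums (\<Sum>n. (norm (t (e n)))\<^sup>2)" using sm by (rule summable_sums)
  qed (rule onb_seq_bessel[OF f])
  then have sw: "summable (\<lambda>m. (norm (w m))\<^sup>2)"
    by (intro summableI_nonneg_bounded) auto
  have "(\<Sum>k<N. (norm (t (f k)))\<^sup>2) \<le> (\<Sum>m. (norm (w m))\<^sup>2)" for N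
  proof (rule sums_le)
    show "(\<lambda>m. \<Sum>k<N. (cmod (cinner (f m) (t (f k))))\<^sup>2) sums (\<Sum>k<N. (norm (t (f k)))\<^sup>2)"
      by (intro sums_sum onb_seq_parseval f)
    show "(\<lambda>m. (norm (w m))\<^sup>2) sums (\<Sum>m. (norm (w m))\<^sup>2)" using sw by (rule summable_sums)
    show "(\<Sum>k<N. (cmod (cinner (f m) (t (f k))))\<^sup>2) \<le> (norm (w m))\<^sup>2" for m
      using onb_seq_bessel[OF f, of "w m" N]
      by (simp add: w[symmetric] cinner_commute[of "w m"])
  qed
  then show ?thesis by (intro summableI_nonneg_bounded) auto
qed

section \<open>From orthonormal bases as sets to basis sequences\<close>

lemma is_onb_countable:
  fixes E :: "'a::complex_hilbert set"
  assumes "separable_space TYPE('a)" "is_onb E"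
  shows "countable E"
proof -
  obtain D :: "'a set" where D: "countable D" "closure D = UNIV"
    using assms(1) by (auto simp: separable_space_def)
  have "\<exists>d\<in>D. dist d x < 1/2" for x
    using D(2) closure_approachable[of x D] by (metis UNIV_I half_gt_zero_iff zero_less_one)
  then obtain h where h: "\<And>x. h x \<in> D" "\<And>x. dist (h x) x < 1/2" by metis
  \<comment> \<open>Distinct basis vectors are at distance \<open>sqrt 2\<close>, so no single point
    of \<open>D\<close> is within \<open>1/2\<close> of two of them.\<close>
  have "inj_on h E"
  proof (rule inj_onI, rule ccontr)
    fix x y assume xy: "x \<in> E" "y \<in> E" "h x = h y" "x \<noteq> y"
    have "dist x y < 1"
      using h(2)[of x] h(2)[of y] dist_triangle_half_r[of "h x" x 1 y] xy(3) by simp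
    moreover have "(norm (x - y))\<^sup>2 = 2"
    proof -
      have "cinner x x = 1" "cinner y y = 1" "cinner x y = 0"
        using assms(2) xy unfolding is_onb_def by auto
      then have "inner x x = 1" "inner y y = 1" "inner x y = 0"
        by (simp_all flip: Re_cinner)
      then show ?thesis by (simp add: power2_norm_eq_inner inner_diff inner_commute)
    qed
    ultimately show False
      using power_mono[of "norm (x - y)" 1 2] by (simp add: dist_norm)
  qed
  then show ?thesis
    using D(1) h(1) by (meson countable_image_inj_on countable_subset image_subsetI)
qed

text \<open>The sequence is padded with zeros outside the range of the enumeration. Functions
  vanishing at 0 do not see the padding, so their sums over \<open>E\<close> and over the indices
  agree.\<close>

lemma is_onb_enumerate:
  fixes E :: "'a::complex_hilbert set"
  assumes E: "is_onb E" and cE: "countable E"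
  obtains e where "onb_seq e"
    and "\<forall>(f :: 'a \<Rightarrow> real) s. f 0 = 0 \<longrightarrow> (f has_sum s) E \<longleftrightarrow> ((\<lambda>n. f (e n)) has_sum s) UNIV"
proof -
  define I where "I = to_nat_on E ` E"
  define e where "e n = (if n \<in> I then from_nat_into E n else 0)" for n
  have bij: "bij_betw (to_nat_on E) E I"
    unfolding I_def using cE by (simp add: bij_betw_def inj_on_to_nat_on)
  have e_to_nat: "e (to_nat_on E x) = x" if "x \<in> E" for x
    using that cE by (simp add: e_def I_def)
  have e_cases: "e n = 0 \<or> (e n \<in> E \<and> n = to_nat_on E (e n))" for n
    using cE by (auto simp: e_def I_def)
  have on: "cinner x y = (if x = y then 1 else 0)" if "x \<in> E" "y \<in> E" for x y
    using E that by (simp add: is_onb_def)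
  have seq: "onb_seq e"
    unfolding onb_seq_def
  proof (intro conjI allI impI)
    fix m n :: nat assume "m \<noteq> n"
    then show "cinner (e m) (e n) = 0"
      using e_cases[of m] e_cases[of n] on[of "e m" "e n"] by (metis cinner_zero_left cinner_zero_right)
  next
    fix n
    have "norm (e n) = 1" if "e n \<in> E"
    proof -
      have "complex_of_real ((norm (e n))\<^sup>2) = complex_of_real 1"
        using on[OF that that] by (simp only: cinner_self) simp
      then have "(norm (e n))\<^sup>2 = 1" by (simp only: of_real_eq_iff)
      then show ?thesis by (simp add: power2_eq_1_iff) (smt (verit) norm_ge_zero)
    qed
    then show "e n = 0 \<or> norm (e n) = 1" using e_cases[of n] by blast
  next
    fix x assume "\<forall>n. cinner (e n) x = 0"
    then show "x = 0" using E e_to_nat unfolding is_onb_def by metis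
  qed
  have iff: "(f has_sum s) E \<longleftrightarrow> ((\<lambda>n. f (e n)) has_sum s) UNIV" if "f 0 = 0" for f :: "'a \<Rightarrow> real" and s
  proof -
    have "(f has_sum s) E \<longleftrightarrow> ((\<lambda>x. f (e (to_nat_on E x))) has_sum s) E"
      by (rule has_sum_cong) (simp add: e_to_nat)
    also have "\<dots> \<longleftrightarrow> ((\<lambda>n. f (e n)) has_sum s) I"
      by (rule has_sum_reindex_bij_betw[OF bij])
    also have "\<dots> \<longleftrightarrow> ((\<lambda>n. f (e n)) has_sum s) UNIV"
      using that by (intro has_sum_cong_neutral) (auto simp: e_def)
    finally show ?thesis .
  qed
  show thesis by (rule that[OF seq]) (simp add: iff)
qed

text \<open>\<open>hilbert_schmidt\<close> allows any basis while \<open>hs_norm\<close> uses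
  \<open>some_onb\<close>; basis independence lets one enumeration of \<open>some_onb\<close>
  describe both. The norm formula assumes only \<open>t 0 = 0\<close> and summability, so it applies
  to remainders not yet known to be Hilbert-Schmidt.\<close>

lemma hilbert_schmidt_onb_seq:
  fixes E :: "'a::complex_hilbert set"
  assumes sep: "separable_space TYPE('a)" and E: "is_onb E"
  obtains e :: "nat \<Rightarrow> 'a" where "onb_seq e"
    and "\<And>t. hilbert_schmidt t \<longleftrightarrow> bounded_op t \<and> summable (\<lambda>n. (norm (t (e n)))\<^sup>2)"
    and "\<And>t. t 0 = 0 \<Longrightarrow> summable (\<lambda>n. (norm (t (e n)))\<^sup>2) \<Longrightarrow>
           hs_norm t = sqrt (\<Sum>n. (norm (t (e n)))\<^sup>2)"
proof -
  have onb: "is_onb (some_onb :: 'a set)"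
    unfolding some_onb_def using E by (rule someI)
  obtain e :: "nat \<Rightarrow> 'a" where e: "onb_seq e"
    and en: "\<forall>(f :: 'a \<Rightarrow> real) s. f 0 = 0 \<longrightarrow> (f has_sum s) some_onb \<longleftrightarrow> ((\<lambda>n. f (e n)) has_sum s) UNIV"
    by (rule is_onb_enumerate[OF onb is_onb_countable[OF sep onb]]) (rule that)
  have "summable (\<lambda>n. (norm (t (e n)))\<^sup>2)" if hs: "hilbert_schmidt t" for t
  proof -
    obtain F where F: "is_onb F" "(\<lambda>x. (norm (t x))\<^sup>2) summable_on F" and t: "bounded_op t"
      using hs unfolding hilbert_schmidt_def by blast
    obtain f where f: "onb_seq f"
      "\<forall>(g :: 'a \<Rightarrow> real) s. g 0 = 0 \<longrightarrow> (g has_sum s) F \<longleftrightarrow> ((\<lambda>n. g (f n)) has_sum s) UNIV"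
      by (rule is_onb_enumerate[OF F(1) is_onb_countable[OF sep F(1)]]) (rule that)
    have "((\<lambda>n. (norm (t (f n)))\<^sup>2) has_sum (\<Sum>\<^sub>\<infinity>x\<in>F. (norm (t x))\<^sup>2)) UNIV"
      using f(2)[rule_format, of "\<lambda>x. (norm (t x))\<^sup>2"] has_sum_infsum[OF F(2)]
      by (simp add: bounded_op_zero[OF t])
    then have "summable (\<lambda>n. (norm (t (f n)))\<^sup>2)"
      by (rule sums_summable[OF has_sum_imp_sums])
    then show ?thesis by (rule hilbert_schmidt_sum_basis_independent[OF f(1) e t])
  qed
  moreover have has_sum: "((\<lambda>x. (norm (t x))\<^sup>2) has_sum (\<Sum>n. (norm (t (e n)))\<^sup>2)) some_onb"
    if "t 0 = 0" "summable (\<lambda>n. (norm (t (e n)))\<^sup>2)" for t :: "'a \<Rightarrow> 'a"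
    using en[rule_format, of "\<lambda>x. (norm (t x))\<^sup>2"] that
      sums_nonneg_imp_has_sum[OF summable_sums[OF that(2)]] by simp
  then have "hilbert_schmidt t" if "bounded_op t" "summable (\<lambda>n. (norm (t (e n)))\<^sup>2)" for t
    unfolding hilbert_schmidt_def
    using that(1) onb has_sum_imp_summable[OF has_sum[OF bounded_op_zero[OF that(1)] that(2)]] by blast
  ultimately have 1: "hilbert_schmidt t \<longleftrightarrow> bounded_op t \<and> summable (\<lambda>n. (norm (t (e n)))\<^sup>2)" for t
    unfolding hilbert_schmidt_def by blast
  have 2: "hs_norm t = sqrt (\<Sum>n. (norm (t (e n)))\<^sup>2)"
    if t: "t 0 = 0" "summable (\<lambda>n. (norm (t (e n)))\<^sup>2)" for t :: "'a \<Rightarrow> 'a"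
    using infsumI[OF has_sum_bounded_linear[OF bounded_linear_of_real has_sum[OF t]]]
    unfolding hs_norm_def hs_inner_def cinner_self by (metis Re_complex_of_real)
  show thesis by (rule that[OF e 1 2])
qed

subsection \<open>Enumerating index pairs by growing squares\<close>

text \<open>The pairs with both entries below \<open>K\<close> come first; then the row \<open>(K, 0), \<dots>, (K, K - 1)\<close>,
  then the column \<open>(0, K), \<dots>, (K, K)\<close>. The first \<open>N\<close> pairs with second entry \<open>i\<close> are those
  whose first entry is below \<open>square_cutoff N i\<close>.\<close>

definition square_pair :: "nat \<Rightarrow> nat \<times> nat" where
  "square_pair n = (let K = floor_sqrt n; R = n - K\<^sup>2 in if R < K then (K, R) else (R - K, K))"

definition square_cutoff :: "nat \<Rightarrow> nat \<Rightarrow> nat" where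
  "square_cutoff N i = (let K = floor_sqrt N; R = N - K\<^sup>2 in
     if i < K then (if i < R then Suc K else K) else if i = K then R - K else 0)"

lemma floor_sqrt_remainder: "n - (floor_sqrt n)\<^sup>2 \<le> 2 * floor_sqrt n"
  using Suc_floor_sqrt_power2_gt[of n] by (simp add: power2_eq_square)

text \<open>Passing from \<open>N\<close> to \<open>Suc N\<close> adds one pair, and its first entry
  is exactly the next free index in its column.\<close>

lemma square_cutoff_Suc:
  "square_cutoff (Suc N) i =
     (if snd (square_pair N) = i then Suc (square_cutoff N i) else square_cutoff N i)"
  "snd (square_pair N) = i \<Longrightarrow> square_cutoff N i = fst (square_pair N)"
proof -
  define K where "K = floor_sqrt N"
  define R where "R = N - K\<^sup>2"
  have R: "R \<le> 2 * K" using floor_sqrt_remainder[of N] by (simp add: R_def K_def)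
  have N: "N = K\<^sup>2 + R" using floor_sqrt_power2_le[of N] by (simp add: R_def K_def)
  have pair: "square_pair N = (if R < K then (K, R) else (R - K, K))"
    by (simp add: square_pair_def Let_def K_def R_def)
  have cut: "square_cutoff N i = (if i < K then (if i < R then Suc K else K) else if i = K then R - K else 0)"
    by (simp add: square_cutoff_def Let_def K_def R_def)
  show "snd (square_pair N) = i \<Longrightarrow> square_cutoff N i = fst (square_pair N)"
    by (auto simp: pair cut split: if_splits)
  show "square_cutoff (Suc N) i =
     (if snd (square_pair N) = i then Suc (square_cutoff N i) else square_cutoff N i)"
  proof (cases "R = 2 * K")
    \<comment> \<open>The block of root \<open>K\<close> has \<open>2 * K + 1\<close> pairs and ends
      with \<open>(K, K)\<close>; the next index is the square of \<open>Suc K\<close>, where the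
      root jumps.\<close>
    case True
    have "floor_sqrt (Suc N) = Suc K"
      by (rule floor_sqrt_unique) (use N True in \<open>auto simp: power2_eq_square\<close>)
    moreover have "Suc N - (Suc K)\<^sup>2 = 0" using N True by (simp add: power2_eq_square)
    ultimately have "square_cutoff (Suc N) i = (if i < Suc K then Suc K else 0)"
      by (simp add: square_cutoff_def Let_def)
    then show ?thesis using True by (auto simp: pair cut)
  next
    case False
    have "floor_sqrt (Suc N) = K"
      by (rule floor_sqrt_unique) (use N R False in \<open>auto simp: power2_eq_square\<close>)
    moreover have "Suc N - K\<^sup>2 = Suc R" using N by simp
    ultimately have "square_cutoff (Suc N) i =
      (if i < K then (if i < Suc R then Suc K else K) else if i = K then Suc R - K else 0)"
      by (simp add: square_cutoff_def Let_def)
    then show ?thesis using R False by (auto simp: pair cut)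
  qed
qed

lemma sum_square_pair_column:
  fixes f :: "nat \<Rightarrow> 'a::comm_monoid_add"
  shows "(\<Sum>n<N. if snd (square_pair n) = i then f (fst (square_pair n)) else 0)
    = (\<Sum>l<square_cutoff N i. f l)"
proof (induction N)
  case 0
  show ?case by (simp add: square_cutoff_def)
next
  case (Suc N)
  then show ?case using square_cutoff_Suc[of N i] by simp
qed

text \<open>For arbitrary column cutoffs growing with \<open>N\<close> one would need control of \<open>\<Sum>i. (SUP m. d m i)\<close>, which
  the hypotheses do not give. Along squares all full columns have cutoff \<open>K\<close> or \<open>K + 1\<close>, and
  only the column \<open>K\<close> is exceptional.\<close>

lemma square_cutoff_sum_tendsto_zero:
  fixes d :: "nat \<Rightarrow> nat \<Rightarrow> real"
  assumes nonneg: "\<And>m i. 0 \<le> d m i" and sm: "\<And>m. summable (d m)"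
    and lim: "(\<lambda>m. suminf (d m)) \<longlonglongrightarrow> 0"
  shows "summable (\<lambda>i. d (square_cutoff N i) i)"
    and "(\<lambda>N. \<Sum>i. d (square_cutoff N i) i) \<longlonglongrightarrow> 0"
proof -
  \<comment> \<open>Column \<open>K\<close> is the one being filled, with a cutoff anywhere in
    \<open>{..K}\<close>; \<open>u K\<close> is its worst case.\<close>
  define u where "u K = Max ((\<lambda>r. d r K) ` {..K})" for K
  \<comment> \<open>A summable majorant for all \<open>N\<close> with root \<open>K\<close>: full
    columns have cutoff \<open>K\<close> or \<open>Suc K\<close>, column \<open>K\<close> is covered
    by \<open>u K\<close>, and later columns have cutoff 0.\<close>
  define g where "g K i = d K i + d (Suc K) i + (if i = K then u K else 0) + (if i < K then 0 else d 0 i)" for K i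
  define G where "G K = suminf (d K) + suminf (d (Suc K)) + u K + (suminf (d 0) - (\<Sum>i<K. d 0 i))" for K
  have g_sums: "g K sums G K" for K
  proof -
    have "(\<lambda>i. if i < K then d 0 i else 0) sums (\<Sum>i<K. d 0 i)"
      using sums_If_finite[of "\<lambda>i. i < K" "d 0"] by (simp add: lessThan_def)
    then have "(\<lambda>i. d 0 i - (if i < K then d 0 i else 0)) sums (suminf (d 0) - (\<Sum>i<K. d 0 i))"
      by (intro sums_diff summable_sums sm)
    moreover have "(\<lambda>i. d 0 i - (if i < K then d 0 i else 0)) = (\<lambda>i. if i < K then 0 else d 0 i)"
      by auto
    ultimately have tail: "(\<lambda>i. if i < K then 0 else d 0 i) sums (suminf (d 0) - (\<Sum>i<K. d 0 i))"
      by simp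
    show ?thesis
      unfolding g_def G_def
      by (rule sums_add[OF sums_add[OF sums_add[OF summable_sums[OF sm] summable_sums[OF sm]]
            sums_single[of K "\<lambda>_. u K"]] tail])
  qed
  have u_ge: "d r K \<le> u K" if "r \<le> K" for r K
    unfolding u_def using that by (intro Max_ge) auto
  have u_nonneg: "0 \<le> u K" for K using u_ge[of 0 K] nonneg[of 0 K] by simp
  have le: "d (square_cutoff N i) i \<le> g (floor_sqrt N) i" for N i
  proof -
    define K where "K = floor_sqrt N"
    have "N - K\<^sup>2 - K \<le> K" using floor_sqrt_remainder[of N] by (simp add: K_def)
    then have "d (N - K\<^sup>2 - K) K \<le> u K" by (rule u_ge)
    moreover have "square_cutoff N i =
        (if i < K then (if i < N - K\<^sup>2 then Suc K else K) else if i = K then N - K\<^sup>2 - K else 0)"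
      by (simp only: square_cutoff_def Let_def K_def)
    ultimately show ?thesis
      using nonneg[of K i] nonneg[of "Suc K" i] nonneg[of 0 i] u_nonneg[of K]
      unfolding g_def K_def[symmetric] by (smt (verit, del_insts))
  qed
  show sm': "summable (\<lambda>i. d (square_cutoff N i) i)" for N
    by (rule summable_comparison_test'[OF sums_summable[OF g_sums[of "floor_sqrt N"]], of 0])
      (use le[of N] nonneg in auto)
  \<comment> \<open>For cutoffs \<open>m \<ge> r0\<close> the entry \<open>d m K\<close> is below
    the small total \<open>suminf (d m)\<close>; for each of the finitely many smaller
    \<open>m\<close> it tends to 0 as a term of a convergent series.\<close>
  have "u \<longlonglongrightarrow> 0"
  proof (rule LIMSEQ_I)
    fix r :: real assume "r > 0"
    then obtain r0 where r0: "\<And>m. m \<ge> r0 \<Longrightarrow> suminf (d m) < r"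
      using LIMSEQ_D[OF lim, of r] by fastforce
    have "eventually (\<lambda>K. d m K < r) sequentially" for m
      using summable_LIMSEQ_zero[OF sm[of m]] \<open>r > 0\<close> by (rule order_tendstoD(2))
    then have "eventually (\<lambda>K. \<forall>m\<in>{..<r0}. d m K < r) sequentially"
      by (simp add: eventually_ball_finite_distrib)
    then obtain K0 where K0: "\<And>K m. K \<ge> K0 \<Longrightarrow> m < r0 \<Longrightarrow> d m K < r"
      by (auto simp: eventually_sequentially)
    have "d m K < r" if "K \<ge> K0" for m K
    proof (cases "m < r0")
      case False
      have "d m K \<le> suminf (d m)"
        using sum_le_suminf[OF sm[of m], of "{K}"] nonneg by simp
      then show ?thesis using r0[of m] False by simp
    qed (use K0 that in auto)
    then have "norm (u K - 0) < r" if "K \<ge> K0" for K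
      using that u_nonneg[of K] by (simp add: u_def)
    then show "\<exists>K0. \<forall>K\<ge>K0. norm (u K - 0) < r" by blast
  qed
  from tendsto_add[OF tendsto_add[OF tendsto_add[OF lim LIMSEQ_Suc[OF lim]] this]
      tendsto_diff[OF tendsto_const summable_LIMSEQ[OF sm[of 0]]]]
  have "G \<longlonglongrightarrow> 0 + 0 + 0 + (suminf (d 0) - suminf (d 0))"
    unfolding G_def[abs_def] .
  then have "G \<longlonglongrightarrow> 0" by simp
  moreover have "filterlim floor_sqrt sequentially sequentially"
    unfolding filterlim_at_top eventually_sequentially
  proof
    show "\<exists>N. \<forall>n\<ge>N. Z \<le> floor_sqrt n" for Z
      by (rule exI[of _ "Z\<^sup>2"]) (simp add: le_floor_sqrt_iff)
  qed
  ultimately have G_lim: "(\<lambda>N. G (floor_sqrt N)) \<longlonglongrightarrow> 0" by (rule filterlim_compose)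
  show "(\<lambda>N. \<Sum>i. d (square_cutoff N i) i) \<longlonglongrightarrow> 0"
  proof (rule tendsto_sandwich[OF always_eventually always_eventually tendsto_const G_lim]; rule allI)
    fix N
    show "0 \<le> (\<Sum>i. d (square_cutoff N i) i)"
      by (rule suminf_nonneg[OF sm']) (rule nonneg)
    show "(\<Sum>i. d (square_cutoff N i) i) \<le> G (floor_sqrt N)"
    proof (rule sums_le)
      show "d (square_cutoff N i) i \<le> g (floor_sqrt N) i" for i by (rule le)
      show "(\<lambda>i. d (square_cutoff N i) i) sums (\<Sum>i. d (square_cutoff N i) i)"
        using sm' by (rule summable_sums)
    qed (rule g_sums)
  qed
qed

subsection \<open>The expansion of an operator\<close>

theorem theorem3p6:
  fixes A :: "('h::complex_hilbert \<Rightarrow> 'h) \<Rightarrow> ('h \<Rightarrow> 'h)"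
  assumes "separable_space TYPE('h)"
    and "bounded_op_S2 A"
  shows "\<exists>a b :: nat \<Rightarrow> 'h \<Rightarrow> 'h.
           (\<forall>n. bounded_op (a n) \<and> bounded_op (b n)) \<and>
           (\<forall>\<eta>. hilbert_schmidt \<eta> \<longrightarrow>
              (\<lambda>N. hs_norm (\<lambda>x. A \<eta> x - (\<Sum>n<N. a n (\<eta> (b n x))))) \<longlonglongrightarrow> 0)"
proof (cases "\<exists>E :: 'h set. is_onb E")
  case False
  \<comment> \<open>Being Hilbert-Schmidt includes the existence of a basis, so here the convergence
    claim is vacuous and any bounded operators serve.\<close>
  then have "\<not> hilbert_schmidt \<eta>" for \<eta> :: "'h \<Rightarrow> 'h"
    by (auto simp: hilbert_schmidt_def)
  then show ?thesis using bounded_op_rank_one by blast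
next
  case True
  then obtain E :: "'h set" where E: "is_onb E" by blast
  obtain e :: "nat \<Rightarrow> 'h" where e: "onb_seq e"
    and hs_iff: "\<And>t. hilbert_schmidt t \<longleftrightarrow> bounded_op t \<and> summable (\<lambda>n. (norm (t (e n)))\<^sup>2)"
    and hs_norm_eq: "\<And>t. t 0 = 0 \<Longrightarrow> summable (\<lambda>n. (norm (t (e n)))\<^sup>2) \<Longrightarrow>
           hs_norm t = sqrt (\<Sum>n. (norm (t (e n)))\<^sup>2)"
    by (rule hilbert_schmidt_onb_seq[OF assms(1) E]) (rule that)

  \<comment> \<open>Squared Hilbert-Schmidt norms in coordinates\<close>
  define S where "S t = (\<Sum>n. (norm (t (e n)))\<^sup>2)" for t :: "'h \<Rightarrow> 'h"
  have S_nonneg: "0 \<le> S t" if "hilbert_schmidt t" for t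
    unfolding S_def using that hs_iff by (intro suminf_nonneg) auto
  have col_le: "(norm (t (e n)))\<^sup>2 \<le> S t" if "hilbert_schmidt t" for t n
    using sum_le_suminf[of "\<lambda>n. (norm (t (e n)))\<^sup>2" "{n}"] that hs_iff by (simp add: S_def)
  have hs_norm_S: "hs_norm t = sqrt (S t)" if "hilbert_schmidt t" for t
    unfolding S_def using that hs_iff bounded_op_zero by (intro hs_norm_eq) auto
  have hs_add: "hilbert_schmidt (\<lambda>x. s x + t x)" if "hilbert_schmidt s" "hilbert_schmidt t" for s t :: "'h \<Rightarrow> 'h"
    unfolding hs_iff
  proof
    show "bounded_op (\<lambda>x. s x + t x)" using that hs_iff bounded_op_add by blast
    have "summable (\<lambda>n. 2 * (norm (s (e n)))\<^sup>2 + 2 * (norm (t (e n)))\<^sup>2)"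
      using that hs_iff by (intro summable_add summable_mult) auto
    then show "summable (\<lambda>n. (norm (s (e n) + t (e n)))\<^sup>2)"
      by (rule summable_comparison_test'[where N = 0]) (use norm_add_sq_le in auto)
  qed
  have hs_scale: "hilbert_schmidt (\<lambda>x. scaleC c (t x))" if "hilbert_schmidt t" for c and t :: "'h \<Rightarrow> 'h"
    using that bounded_op_scale[of t c]
    unfolding hs_iff by (auto simp: norm_scaleC power_mult_distrib intro: summable_mult)
  have rank_one_S: "hilbert_schmidt (rank_one x (e l))" "S (rank_one x (e l)) \<le> (norm x)\<^sup>2" for x l
  proof -
    let ?r = "(norm (scaleC (cinner (e l) (e l)) x))\<^sup>2"
    have "(\<lambda>n. (norm (rank_one x (e l) (e n)))\<^sup>2) = (\<lambda>n. if n = l then ?r else 0)"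
      using e by (auto simp: rank_one_onb)
    then have sums: "(\<lambda>n. (norm (rank_one x (e l) (e n)))\<^sup>2) sums ?r"
      using sums_single[of l "\<lambda>_. ?r"] by simp
    then show "hilbert_schmidt (rank_one x (e l))"
      by (auto simp: hs_iff bounded_op_rank_one sums_iff)
    have "cmod (cinner (e l) (e l)) \<le> 1"
      using onb_seq_norm_le[OF e, of l] by (simp add: cinner_self norm_power power_le_one)
    then have "norm (scaleC (cinner (e l) (e l)) x) \<le> norm x"
      by (simp add: norm_scaleC mult_left_le_one_le)
    then show "S (rank_one x (e l)) \<le> (norm x)\<^sup>2"
      using sums by (simp add: S_def sums_iff power_mono)
  qed
  have A_hs: "hilbert_schmidt (A t)" if "hilbert_schmidt t" for t
    using assms(2) that by (simp add: bounded_op_S2_def)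
  have A_add: "A (\<lambda>x. s x + t x) = (\<lambda>x. A s x + A t x)" if "hilbert_schmidt s" "hilbert_schmidt t" for s t
    using assms(2) that by (simp add: bounded_op_S2_def)
  have A_scale: "A (\<lambda>x. scaleC c (t x)) = (\<lambda>x. scaleC c (A t x))" if "hilbert_schmidt t" for c t
    using assms(2) that by (simp add: bounded_op_S2_def)
  obtain K where K: "\<And>t. hilbert_schmidt t \<Longrightarrow> hs_norm (A t) \<le> K * hs_norm t"
    using assms(2) by (auto simp: bounded_op_S2_def)
  have A_S: "S (A t) \<le> K\<^sup>2 * S t" if "hilbert_schmidt t" for t
    using power_mono[OF K[OF that], of 2] that A_hs[OF that] S_nonneg
    by (simp add: hs_norm_S power_mult_distrib)
  have hs_zero: "hilbert_schmidt (\<lambda>x. 0 :: 'h)"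
    using hs_scale[OF rank_one_S(1), of 0] by simp
  have A_zero: "A (\<lambda>x. 0) = (\<lambda>x. 0)"
    using A_scale[OF hs_zero, of 0] by simp
  define a where "a l j x = A (rank_one x (e l)) (e j)" for l j x
  define b where "b l j = rank_one (e l) (e j)" for l j
  have a_bounded: "bounded_op (a l j)" for l j
  \<comment> \<open>The sign of \<open>K\<close> is unknown, so estimates use its square and its
    absolute value. A single column is bounded by the whole Hilbert-Schmidt norm.\<close>
  proof (rule bounded_opI[where K = "\<bar>K\<bar>"])
    fix x y c
    have "rank_one (x + y) (e l) = (\<lambda>z. rank_one x (e l) z + rank_one y (e l) z)"
      by (simp add: rank_one_def fun_eq_iff scaleC_add_right)
    then show "a l j (x + y) = a l j x + a l j y"
      by (simp add: a_def A_add rank_one_S)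
    have "rank_one (scaleC c x) (e l) = (\<lambda>z. scaleC c (rank_one x (e l) z))"
      by (simp add: rank_one_def fun_eq_iff scaleC_scaleC mult.commute)
    then show "a l j (scaleC c x) = scaleC c (a l j x)"
      by (simp add: a_def A_scale rank_one_S)
    have "(norm (a l j x))\<^sup>2 \<le> K\<^sup>2 * S (rank_one x (e l))"
      unfolding a_def using col_le A_S A_hs rank_one_S(1) order_trans by blast
    also have "\<dots> \<le> K\<^sup>2 * (norm x)\<^sup>2"
      by (intro mult_left_mono rank_one_S) auto
    finally have "(norm (a l j x))\<^sup>2 \<le> (\<bar>K\<bar> * norm x)\<^sup>2"
      by (simp add: power_mult_distrib)
    then show "norm (a l j x) \<le> \<bar>K\<bar> * norm x"
      by (rule power2_le_imp_le) simp
  qed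
  have b_bounded: "bounded_op (b l j)" for l j
    unfolding b_def by (rule bounded_op_rank_one)
  have conv: "(\<lambda>N. hs_norm (\<lambda>x. A \<eta> x -
      (\<Sum>n<N. case_prod a (square_pair n) (\<eta> (case_prod b (square_pair n) x))))) \<longlonglongrightarrow> 0"
    if \<eta>: "hilbert_schmidt \<eta>" for \<eta>
  proof -
    have \<eta>b: "bounded_op \<eta>" and \<eta>s: "summable (\<lambda>n. (norm (\<eta> (e n)))\<^sup>2)"
      using \<eta> hs_iff by auto
    define R where "R l = rank_one (\<eta> (e l)) (e l)" for l
    have R_hs: "hilbert_schmidt (R l)" for l unfolding R_def by (rule rank_one_S)
    \<comment> \<open>Additivity of \<open>A\<close> is available only on Hilbert-Schmidt arguments,
      so membership and the formula are proved together. The sum of the \<open>R l\<close> is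
      \<open>\<eta>\<close> composed with the projection onto the first \<open>m\<close> basis
      vectors.\<close>
    have trunc: "hilbert_schmidt (\<lambda>x. \<Sum>l<m. R l x) \<and> A (\<lambda>x. \<Sum>l<m. R l x) = (\<lambda>x. \<Sum>l<m. A (R l) x)" for m
      by (induction m) (simp_all add: hs_zero A_zero hs_add A_add R_hs)
    \<comment> \<open>The difference is written with \<open>scaleC (-1)\<close> to match the
      additivity and homogeneity of \<open>A\<close>.\<close>
    define \<rho> where "\<rho> m x = \<eta> x + scaleC (-1) (\<Sum>l<m. R l x)" for m x
    have \<rho>_hs: "hilbert_schmidt (\<rho> m)" for m
      unfolding \<rho>_def using \<eta> trunc by (intro hs_add hs_scale) auto
    have A\<rho>: "A (\<rho> m) x = A \<eta> x - (\<Sum>l<m. A (R l) x)" for m x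
    proof -
      have "A (\<rho> m) = (\<lambda>x. A \<eta> x + A (\<lambda>x. scaleC (-1) (\<Sum>l<m. R l x)) x)"
        unfolding \<rho>_def using \<eta> trunc hs_scale by (intro A_add) blast+
      then show ?thesis
        using trunc[of m] A_scale[of "\<lambda>x. \<Sum>l<m. R l x" "-1"] by simp
    qed
    have \<rho>_e: "\<rho> m (e n) = (if n < m then 0 else \<eta> (e n))" for m n
    proof -
      have "R l (e n) = (if l = n then \<eta> (e n) else 0)" for l
        using onb_seq_scaleC_self[OF e, of n] bounded_op_scaleC[OF \<eta>b, of "cinner (e n) (e n)" "e n"]
        by (simp add: R_def rank_one_onb[OF e])
      then show ?thesis by (simp add: \<rho>_def)
    qed
    \<comment> \<open>\<open>\<rho> m\<close> keeps the columns of \<open>\<eta>\<close> from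
      \<open>m\<close> on, so its squared norm is a tail of a convergent series.\<close>
    have S\<rho>: "S (\<rho> m) = S \<eta> - (\<Sum>n<m. (norm (\<eta> (e n)))\<^sup>2)" for m
    proof -
      have "(\<lambda>n. if n < m then (norm (\<eta> (e n)))\<^sup>2 else 0) sums (\<Sum>n<m. (norm (\<eta> (e n)))\<^sup>2)"
        using sums_If_finite[of "\<lambda>n. n < m" "\<lambda>n. (norm (\<eta> (e n)))\<^sup>2"] by (simp add: lessThan_def)
      then have "(\<lambda>n. (norm (\<eta> (e n)))\<^sup>2 - (if n < m then (norm (\<eta> (e n)))\<^sup>2 else 0)) sums
          (S \<eta> - (\<Sum>n<m. (norm (\<eta> (e n)))\<^sup>2))"
        unfolding S_def by (intro sums_diff summable_sums \<eta>s)
      moreover have "(\<lambda>n. (norm (\<eta> (e n)))\<^sup>2 - (if n < m then (norm (\<eta> (e n)))\<^sup>2 else 0)) =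
          (\<lambda>n. (norm (\<rho> m (e n)))\<^sup>2)"
        by (auto simp: \<rho>_e)
      ultimately show ?thesis by (simp add: S_def sums_iff)
    qed
    define d where "d m i = (norm (A (\<rho> m) (e i)))\<^sup>2" for m i
    have d_sum: "suminf (d m) = S (A (\<rho> m))" for m by (simp add: d_def[abs_def] S_def)
    have d_sm: "summable (d m)" for m
      using A_hs[OF \<rho>_hs[of m]] by (simp add: d_def[abs_def] hs_iff)
    have "(\<lambda>m. K\<^sup>2 * S (\<rho> m)) \<longlonglongrightarrow> K\<^sup>2 * (S \<eta> - S \<eta>)"
      unfolding S\<rho> by (intro tendsto_intros) (unfold S_def, rule summable_LIMSEQ[OF \<eta>s])
    then have S\<rho>_lim: "(\<lambda>m. K\<^sup>2 * S (\<rho> m)) \<longlonglongrightarrow> 0" by simp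
    have d_lim: "(\<lambda>m. suminf (d m)) \<longlonglongrightarrow> 0"
    proof (rule tendsto_sandwich[OF always_eventually always_eventually tendsto_const S\<rho>_lim]; rule allI)
      show "0 \<le> suminf (d m)" for m unfolding d_sum by (intro S_nonneg A_hs \<rho>_hs)
      show "suminf (d m) \<le> K\<^sup>2 * S (\<rho> m)" for m unfolding d_sum by (intro A_S \<rho>_hs)
    qed
    have d_nonneg: "0 \<le> d m i" for m i by (simp add: d_def)
    note lim = square_cutoff_sum_tendsto_zero[OF d_nonneg d_sm d_lim]
    define D where "D N x = A \<eta> x -
      (\<Sum>n<N. case_prod a (square_pair n) (\<eta> (case_prod b (square_pair n) x)))" for N x
    \<comment> \<open>For \<open>j = i\<close> the scalar \<open>cinner (e i) (e i)\<close> is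
      pulled out through all operators and then put back into \<open>e i\<close>, which covers zero
      entries too.\<close>
    have term_e: "a l j (\<eta> (b l j (e i))) = (if j = i then A (R l) (e i) else 0)" for l j i
    proof (cases "j = i")
      case True
      have "a l i (\<eta> (b l i (e i))) = scaleC (cinner (e i) (e i)) (a l i (\<eta> (e l)))"
        by (simp add: b_def rank_one_def bounded_op_scaleC[OF \<eta>b] bounded_op_scaleC[OF a_bounded])
      also have "\<dots> = A (R l) (scaleC (cinner (e i) (e i)) (e i))"
        using A_hs[OF R_hs[of l]] by (simp add: a_def R_def hs_iff bounded_op_scaleC)
      finally show ?thesis using True by (simp add: onb_seq_scaleC_self[OF e])
    next
      case False
      then have "b l j (e i) = 0" by (simp add: b_def rank_one_onb[OF e])
      then show ?thesis using False by (simp add: bounded_op_zero \<eta>b a_bounded)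
    qed
    \<comment> \<open>In column \<open>i\<close> only pairs with second entry \<open>i\<close>
      survive, so the partial sum truncates the expansion there at \<open>square_cutoff N i\<close>,
      a cutoff depending on the column.\<close>
    have D_e: "D N (e i) = A (\<rho> (square_cutoff N i)) (e i)" for N i
      unfolding D_def A\<rho> sum_square_pair_column[symmetric]
      by (simp add: case_prod_unfold term_e)
    have "D N 0 = 0" for N
      using A_hs[OF \<eta>]
      by (simp add: D_def case_prod_unfold bounded_op_zero \<eta>b a_bounded b_bounded hs_iff)
    then have "hs_norm (D N) = sqrt (\<Sum>i. d (square_cutoff N i) i)" for N
      using lim(1)[of N] by (subst hs_norm_eq) (simp_all add: D_e d_def)
    moreover have "(\<lambda>N. sqrt (\<Sum>i. d (square_cutoff N i) i)) \<longlonglongrightarrow> 0"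
      using tendsto_real_sqrt[OF lim(2)] by simp
    ultimately show ?thesis by (simp add: D_def[abs_def])
  qed
  show ?thesis
    by (intro exI[of _ "\<lambda>n. case_prod a (square_pair n)"] exI[of _ "\<lambda>n. case_prod b (square_pair n)"])
      (use conv a_bounded b_bounded in \<open>auto simp: case_prod_unfold\<close>)
qed

end
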